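(* For each $n\in\mathbb{N}$, each graph of infinite minimum degree admits an $\omega_n$-unfriendly partition.
   Context: A graph is a pair $G=(V,E)$ where $V$ is the set of vertices and $E$ is the set of edges; edges are unordered pairs $\{x,y\}$ with $x,y\in V$, $x\neq y$. Graphs may be infinite of any cardinality. The neighbours of a vertex $x$ are the vertices $y$ with $\{x,y\}\in E$; the degree of $x$ is the cardinal of its set of neighbours; the minimum degree of $G$ is the minimum of the degrees of its vertices. A partition of $G$ is a map $\pi:V\to\{0,1\}$. For a cardinal $\kappa$, $\pi$ is $\kappa$-unfriendly if, for each $x\in V$, the cardinal $|\{y\in V\mid\{x,y\}\in E\text{ and }\pi(y)\neq\pi(x)\}|$ is $\geq\kappa$ or is $\geq|\{y\in V\mid\{x,y\}\in E\text{ and }\pi(y)=\pi(x)\}|$. Here $\omega_n$ denotes the $n$-th infinite cardinal $\aleph_n$ (with $\omega_0=\omega=\aleph_0$). *)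

theory Defs
  imports Main
begin

unbundle cardinal_syntax

definition graph :: "'a set \<Rightarrow> 'a set set \<Rightarrow> bool" where
  "graph V E \<longleftrightarrow> (\<forall>e\<in>E. \<exists>x\<in>V. \<exists>y\<in>V. x \<noteq> y \<and> e = {x, y})"

definition neighbours :: "'a set \<Rightarrow> 'a set set \<Rightarrow> 'a \<Rightarrow> 'a set" where
  "neighbours V E x = {y \<in> V. {x, y} \<in> E}"

definition vdegree :: "'a set \<Rightarrow> 'a set set \<Rightarrow> 'a \<Rightarrow> 'a rel" where
  "vdegree V E x = |neighbours V E x|"

(* The minimum exists and is unique up to =o whenever V is nonempty, since cardinals are
   well-ordered; it is unspecified for the empty graph. *)
definition min_degree :: "'a set \<Rightarrow> 'a set set \<Rightarrow> 'a rel" where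
  "min_degree V E = (SOME k. k \<in> vdegree V E ` V \<and> (\<forall>x\<in>V. k \<le>o vdegree V E x))"

definition is_partition :: "'a set \<Rightarrow> ('a \<Rightarrow> nat) \<Rightarrow> bool" where
  "is_partition V p \<longleftrightarrow> p ` V \<subseteq> {0, 1}"

definition opposite_nbrs :: "'a set \<Rightarrow> 'a set set \<Rightarrow> ('a \<Rightarrow> nat) \<Rightarrow> 'a \<Rightarrow> 'a set" where
  "opposite_nbrs V E p x = {y \<in> V. {x, y} \<in> E \<and> p y \<noteq> p x}"

definition same_nbrs :: "'a set \<Rightarrow> 'a set set \<Rightarrow> ('a \<Rightarrow> nat) \<Rightarrow> 'a \<Rightarrow> 'a set" where
  "same_nbrs V E p x = {y \<in> V. {x, y} \<in> E \<and> p y = p x}"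

definition unfriendly :: "'k rel \<Rightarrow> 'a set \<Rightarrow> 'a set set \<Rightarrow> ('a \<Rightarrow> nat) \<Rightarrow> bool" where
  "unfriendly k V E p \<longleftrightarrow> is_partition V p \<and>
     (\<forall>x\<in>V. k \<le>o |opposite_nbrs V E p x| \<or> |same_nbrs V E p x| \<le>o |opposite_nbrs V E p x| )"

(* Each cardSuc changes the type ('k rel to 'k set rel), so it cannot be iterated to a function
   n |-> omega_n.  Hence the n-th infinite cardinal is described by a predicate, meaningful
   at every type: a type with a representative of omega_(n+1) also has one of omega_n. *)
fun is_omega :: "nat \<Rightarrow> 'k rel \<Rightarrow> bool" where
  "is_omega 0 r \<longleftrightarrow> r =o natLeq"
| "is_omega (Suc n) r \<longleftrightarrow> (\<exists>s::'k rel. is_omega n s \<and> r =o cardSuc s)"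

(* omega_n <= |A|.  The representative of omega_n may be sought in the type of the elements of A:
   if none exists there, then |A| < omega_n.  See omega_le_card_iff. *)
definition omega_le_card :: "nat \<Rightarrow> 'a set \<Rightarrow> bool" where
  "omega_le_card n A \<longleftrightarrow> (\<exists>k::'a rel. is_omega n k \<and> k \<le>o |A| )"

(* Being omega_n-unfriendly, for all n at a single type; see omega_unfriendly_iff. *)
definition omega_unfriendly :: "nat \<Rightarrow> 'a set \<Rightarrow> 'a set set \<Rightarrow> ('a \<Rightarrow> nat) \<Rightarrow> bool" where
  "omega_unfriendly n V E p \<longleftrightarrow> is_partition V p \<and>
     (\<forall>x\<in>V. omega_le_card n (opposite_nbrs V E p x) \<or> |same_nbrs V E p x| \<le>o |opposite_nbrs V E p x| )"

lemma is_omega_Card_order: "is_omega n r \<Longrightarrow> Card_order r"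
proof (induction n arbitrary: r)
  case 0
  then show ?case
    using Card_order_ordIso natLeq_Card_order by auto
next
  case (Suc n)
  then show ?case
    using Card_order_ordIso cardSuc_Card_order by fastforce
qed

lemma is_omega_ordIso:
  fixes r :: "'k rel" and r' :: "'l rel"
  assumes "is_omega n r" "r' =o r"
  shows "is_omega n r'"
  using assms
proof (induction n arbitrary: r r')
  case 0
  then show ?case
    using ordIso_transitive by auto
next
  case (Suc n)
  then obtain s :: "'k rel" where s: "is_omega n s" "r =o cardSuc s"
    by auto
  then have cs: "Card_order s"
    using is_omega_Card_order by blast
  have r'_eq: "r' =o cardSuc s"
    using Suc.prems(2) s(2) by (rule ordIso_transitive)
  have "s <o r'"
    using cardSuc_greater[OF cs] ordIso_symmetric[OF r'_eq] by (rule ordLess_ordIso_trans)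
  then obtain t :: "'l rel" where t: "s =o t"
    using internalize_ordLess[of s r'] by blast
  then have t': "t =o s"
    by (rule ordIso_symmetric)
  then have omt: "is_omega n t"
    using Suc.IH s(1) by blast
  have "cardSuc s =o cardSuc t"
    using cardSuc_invar_ordIso[OF cs is_omega_Card_order[OF omt]] t by blast
  with r'_eq have "r' =o cardSuc t"
    by (rule ordIso_transitive)
  then show ?case
    using omt by auto
qed

lemma is_omega_unique:
  fixes r :: "'k rel" and r' :: "'l rel"
  assumes "is_omega n r" "is_omega n r'"
  shows "r =o r'"
  using assms
proof (induction n arbitrary: r r')
  case 0
  then show ?case
    using ordIso_symmetric ordIso_transitive by fastforce
next
  case (Suc n)
  then obtain s :: "'k rel" and s' :: "'l rel"
    where s: "is_omega n s" "r =o cardSuc s" "is_omega n s'" "r' =o cardSuc s'"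
    by auto
  have "cardSuc s =o cardSuc s'"
    using cardSuc_invar_ordIso[OF is_omega_Card_order[OF s(1)] is_omega_Card_order[OF s(3)]]
      Suc.IH[OF s(1,3)] by blast
  with s(2) have "r =o cardSuc s'"
    by (rule ordIso_transitive)
  then show ?case
    using ordIso_symmetric[OF s(4)] by (rule ordIso_transitive)
qed

lemma is_omega_cardSuc:
  fixes r :: "'k rel"
  assumes "is_omega n r"
  shows "is_omega (Suc n) (cardSuc r)"
proof -
  have cr: "Card_order r"
    using assms by (rule is_omega_Card_order)
  obtain s :: "'k set rel" where s: "r =o s"
    using cardSuc_greater[OF cr] internalize_ordLess[of r "cardSuc r"] by blast
  then have oms: "is_omega n s"
    using is_omega_ordIso assms ordIso_symmetric by blast
  have "cardSuc r =o cardSuc s"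
    using cardSuc_invar_ordIso[OF cr is_omega_Card_order[OF oms]] s by blast
  then show ?thesis
    using oms by auto
qed

lemma omega_le_card_iff:
  fixes k :: "'k rel" and A :: "'a set"
  assumes "is_omega n k"
  shows "omega_le_card n A \<longleftrightarrow> k \<le>o |A|"
proof
  assume "omega_le_card n A"
  then show "k \<le>o |A|"
    unfolding omega_le_card_def
    using is_omega_unique[OF assms] ordIso_ordLeq_trans by blast
next
  assume "k \<le>o |A|"
  then obtain s :: "'a rel" where s: "k =o s" "s \<le>o |A|"
    using internalize_ordLeq[of k "|A|"] by blast
  then have "is_omega n s"
    using is_omega_ordIso assms ordIso_symmetric by blast
  then show "omega_le_card n A"
    unfolding omega_le_card_def using s(2) by blast
qed

lemma omega_unfriendly_iff:
  assumes "is_omega n k"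
  shows "omega_unfriendly n V E p \<longleftrightarrow> unfriendly k V E p"
  unfolding omega_unfriendly_def unfriendly_def omega_le_card_iff[OF assms] ..

lemma cinfinite_min_degree_iff:
  assumes "V \<noteq> {}"
  shows "cinfinite (min_degree V E) \<longleftrightarrow> (\<forall>x\<in>V. infinite (neighbours V E x))"
proof -
  have "\<exists>k\<in>vdegree V E ` V. \<forall>k'\<in>vdegree V E ` V. k \<le>o k'"
    using exists_minim_Well_order[of "vdegree V E ` V"] assms
    unfolding vdegree_def by (auto simp: card_of_Well_order)
  then have "\<exists>k. k \<in> vdegree V E ` V \<and> (\<forall>x\<in>V. k \<le>o vdegree V E x)"
    by blast
  then have *: "min_degree V E \<in> vdegree V E ` V \<and> (\<forall>x\<in>V. min_degree V E \<le>o vdegree V E x)"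
    unfolding min_degree_def by (rule someI_ex)
  then obtain z where z: "z \<in> V" "min_degree V E = |neighbours V E z|"
    unfolding vdegree_def by blast
  have "infinite (neighbours V E x)" if "infinite (neighbours V E z)" "x \<in> V" for x
    using * that z card_of_ordLeq_infinite unfolding vdegree_def by metis
  then show ?thesis
    using z by (auto simp: cinfinite_def Field_card_of)
qed

end

theory Submission
  imports Defs
begin

text \<open>
  Give every vertex \<open>x\<close> of the graph the demand \<open>d x\<close>, the smaller of its degree and
  \<open>\<omega>\<^sub>n\<close>. Since all degrees are infinite, a partition is \<open>\<omega>\<^sub>n\<close>-unfriendly as soon as every \<open>x\<close>
  has at least \<open>d x\<close> neighbours of the other colour. The demands take only the finitely many values
  \<open>\<omega>\<^sub>0, \<dots>, \<omega>\<^sub>n\<close>, all of them regular, and each is at most the degree. For such demands a colouring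
  is found by induction on the number of values
  (\<open>unfriendly_for_finitely_many_stable_demands\<close>).

  Maximality (\<open>unfriendly_by_exhaustion\<close>). Take a maximal partial colouring in which every coloured
  vertex already has its demand met. An uncoloured vertex with at least \<open>d x\<close> coloured neighbours
  has that many of one colour and could take the other colour; so every uncoloured vertex still has
  \<open>d x\<close> uncoloured neighbours. It therefore suffices to find inside the uncoloured part one nonempty
  set with a colouring that meets all demands within that set. Let \<open>\<kappa>\<close> be the largest demand.
  Closing a vertex under \<open>d x\<close> chosen neighbours of each \<open>x\<close> gives a set \<open>U\<close> of size at most \<open>\<kappa>\<close>
  in which all demands can still be met, and the induction hypothesis gives a colouring \<open>p\<close> of \<open>U\<close>
  that meets the demands below \<open>\<kappa>\<close>.

  From \<open>p\<close> to all demands (\<open>one_more_demand\<close>). If \<open>p\<close> meets all demands within some nonempty subset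
  of \<open>U\<close>, that subset is as required. If not, the vertices of \<open>U\<close> can be removed transfinitely, each
  having fewer than \<open>d x\<close> neighbours of opposite colour among those not removed before it. So the
  edges between the two colours can be oriented with fewer than \<open>d x\<close> of them leaving each \<open>x\<close>
  (\<open>ex_orientation\<close>). A low vertex, one with \<open>d x < \<kappa>\<close>, has \<open>d x\<close> opposite neighbours and hence
  \<open>d x\<close> of them along incoming edges; it secures \<open>d x\<close> such edges. A vertex lies on fewer than \<open>\<kappa>\<close>
  secured edges: either it secured them itself, or they leave it in the orientation. As \<open>\<kappa>\<close> is
  regular, the components formed by the secured edges have fewer than \<open>\<kappa>\<close> vertices (for \<open>\<kappa> = \<omega>\<close> no
  vertex is low, and every component is a single vertex). Exchanging the two colours on whole
  components keeps the demands of all low vertices met, since both ends of a secured edge change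
  together. A vertex of demand \<open>\<kappa>\<close> has \<open>\<kappa>\<close> neighbours in \<open>U\<close>, spread over \<open>\<kappa>\<close> small components, and
  there are at most \<open>\<kappa>\<close> such vertices; a recursion of length \<open>\<kappa>\<close> treats one component at a time and
  gives each vertex of demand \<open>\<kappa>\<close> that many neighbours of either colour (\<open>recolour_components\<close>). The result meets all demands in \<open>U\<close>.
\<close>

section \<open>Cardinal bounds\<close>

lemma not_le_card_iff:
  assumes "Card_order k"
  shows "\<not> k \<le>o |A| \<longleftrightarrow> |A| <o k"
  using assms by (intro not_ordLeq_iff_ordLess) (auto simp: card_order_on_def card_of_Well_order)

lemma le_card_Un:
  assumes "Cinfinite k" "k \<le>o |A \<union> B|"
  shows "k \<le>o |A| \<or> k \<le>o |B|"
proof -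
  have co: "Card_order k" and "infinite (Field k)"
    using assms(1) by (simp_all add: cinfinite_def)
  then have "|A| <o k \<Longrightarrow> |B| <o k \<Longrightarrow> |A \<union> B| <o k"
    by (intro card_of_Un_ordLess_infinite_Field)
  then show ?thesis
    using assms(2) unfolding not_le_card_iff[OF co, symmetric] by blast
qed

lemma le_card_mono: "k \<le>o |A| \<Longrightarrow> A \<subseteq> B \<Longrightarrow> k \<le>o |B|"
  by (rule ordLeq_transitive[OF _ card_of_mono1])

lemma card_less_mono: "|B| <o k \<Longrightarrow> A \<subseteq> B \<Longrightarrow> |A| <o k"
  by (rule ordLeq_ordLess_trans[OF card_of_mono1])

lemma finite_card_less: "Cinfinite k \<Longrightarrow> finite A \<Longrightarrow> |A| <o k"
  by (intro Cfinite_ordLess_Cinfinite) (simp_all add: cfinite_def Field_card_of card_of_card_order_on)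

lemma obtain_subset_of_card:
  assumes "Card_order k" "k \<le>o |A|"
  obtains B where "B \<subseteq> A" "|B| =o k"
proof -
  have "|Field k| \<le>o |A|"
    using card_of_Field_ordIso[OF assms(1)] assms(2) by (rule ordIso_ordLeq_trans)
  then obtain f where f: "inj_on f (Field k)" "f ` Field k \<subseteq> A"
    unfolding card_of_ordLeq[symmetric] by blast
  have "|f ` Field k| =o |Field k|"
    using card_of_ordIsoI[OF inj_on_imp_bij_betw[OF f(1)]] by (rule ordIso_symmetric)
  then have "|f ` Field k| =o k"
    using card_of_Field_ordIso[OF assms(1)] by (rule ordIso_transitive)
  then show ?thesis using that f by blast
qed

text \<open>The set of vertices reachable from \<open>a\<close> is a countable union of levels, each of size below \<open>k\<close>
  by induction. Beyond stability this uses \<open>natLeq <o k\<close>: in a graph of finite out-degrees the set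
  may be infinite.\<close>

lemma card_rtrancl_less:
  assumes "Cinfinite k" "stable k" "natLeq <o k" "\<And>x. |r `` {x}| <o k"
  shows "|r\<^sup>* `` {a}| <o k"
proof -
  have "|(r ^^ n) `` {a}| <o k" for n
  proof (induction n)
    case 0
    show ?case using finite_card_less[OF assms(1), of "{a}"] by simp
  next
    case (Suc n)
    have "(r ^^ Suc n) `` {a} = (\<Union>x\<in>(r ^^ n) `` {a}. r `` {x})"
      by auto
    also have "|\<dots>| <o k"
      by (rule stable_UNION[OF assms(2) Suc assms(4)])
    finally show ?case .
  qed
  moreover have "|UNIV :: nat set| <o k"
    using card_of_nat assms(3) by (rule ordIso_ordLess_trans)
  ultimately have "|\<Union>n\<in>UNIV :: nat set. (r ^^ n) `` {a}| <o k"
    by (intro stable_UNION[OF assms(2)])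
  moreover have "r\<^sup>* `` {a} = (\<Union>n\<in>UNIV :: nat set. (r ^^ n) `` {a})"
    by (auto simp: rtrancl_power)
  ultimately show ?thesis by simp
qed

section \<open>Maximal partial colourings\<close>

definition opposite :: "('a \<Rightarrow> 'a set) \<Rightarrow> ('a \<Rightarrow> bool) \<Rightarrow> 'a \<Rightarrow> 'a set" where
  "opposite N p x = {y \<in> N x. p y \<noteq> p x}"

text \<open>Demands met by a partial colouring stay met when it is extended, so Zorn's lemma gives a
  maximal one. In its uncoloured part \<open>U\<close> there is no vertex outside \<open>X\<close>, and none with fewer than
  \<open>d x\<close> neighbours in \<open>U\<close>: such a vertex would have \<open>d x\<close> neighbours of one colour and could take
  the other. A nonempty \<open>U\<close> would thus satisfy the hypotheses of \<open>seed\<close> and could be coloured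
  further.\<close>

lemma unfriendly_by_exhaustion:
  assumes d: "\<And>x. x \<in> X \<Longrightarrow> Cinfinite (d x)"
    and deg: "\<And>x. x \<in> X \<Longrightarrow> d x \<le>o |N x|"
    and seed: "\<And>U. U \<subseteq> X \<Longrightarrow> U \<noteq> {} \<Longrightarrow> (\<And>x. x \<in> U \<Longrightarrow> d x \<le>o |N x \<inter> U| ) \<Longrightarrow>
      \<exists>B q. B \<noteq> {} \<and> B \<subseteq> U \<and> (\<forall>x\<in>B. d x \<le>o |opposite N q x \<inter> B| )"
  shows "\<exists>p. \<forall>x\<in>X. d x \<le>o |opposite N p x|"
proof -
  \<comment> \<open>partial colourings as graphs of functions, so that chains have unions\<close>
  define ok where "ok c \<longleftrightarrow> single_valued c \<and>
    (\<forall>(x, b)\<in>c. x \<in> X \<longrightarrow> d x \<le>o |{y \<in> N x. (y, \<not> b) \<in> c}| )" for c :: "('a \<times> bool) set"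
  have "\<exists>M\<in>Collect ok. \<forall>c\<in>Collect ok. M \<subseteq> c \<longrightarrow> c = M"
  proof (rule subset_Zorn')
    fix C assume C: "subset.chain (Collect ok) C"
    have "single_valued (\<Union>C)"
      unfolding single_valued_def
    proof (intro allI impI)
      fix x b b' assume "(x, b) \<in> \<Union>C" "(x, b') \<in> \<Union>C"
      then obtain c c' where "c \<in> C" "c' \<in> C" "(x, b) \<in> c" "(x, b') \<in> c'" by blast
      moreover have "c \<subseteq> c' \<or> c' \<subseteq> c" "ok c" "ok c'"
        using C \<open>c \<in> C\<close> \<open>c' \<in> C\<close> unfolding subset.chain_def by blast+
      ultimately show "b = b'"
        unfolding ok_def single_valued_def by blast
    qed
    moreover have "d x \<le>o |{y \<in> N x. (y, \<not> b) \<in> \<Union>C}|" if xb: "(x, b) \<in> \<Union>C" "x \<in> X" for x b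
    proof -
      obtain c where c: "c \<in> C" "(x, b) \<in> c" using xb(1) by blast
      then have "ok c" using C unfolding subset.chain_def by blast
      then have "d x \<le>o |{y \<in> N x. (y, \<not> b) \<in> c}|"
        using c(2) xb(2) unfolding ok_def by blast
      then show ?thesis
        by (rule le_card_mono) (use c in blast)
    qed
    ultimately show "\<Union>C \<in> Collect ok" unfolding ok_def by blast
  qed
  then obtain c where c: "ok c" and max: "\<And>c'. ok c' \<Longrightarrow> c \<subseteq> c' \<Longrightarrow> c' = c" by blast
  \<comment> \<open>maximality: no set of new vertices can be coloured with its own demands met\<close>
  have ext: False
    if new: "B \<noteq> {}" "B \<inter> Domain c = {}"
      and sat: "\<And>x. x \<in> B \<Longrightarrow> x \<in> X \<Longrightarrow>
        d x \<le>o |{y \<in> N x. (y, \<not> q x) \<in> c} \<union> (opposite N q x \<inter> B)|" for B q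
  proof -
    define c' where "c' = c \<union> (\<lambda>x. (x, q x)) ` B"
    have "single_valued c'"
      using c new unfolding c'_def ok_def single_valued_def by blast
    moreover have "d x \<le>o |{y \<in> N x. (y, \<not> b) \<in> c'}|" if xb: "(x, b) \<in> c'" "x \<in> X" for x b
    proof (cases "x \<in> B")
      case False
      then have "d x \<le>o |{y \<in> N x. (y, \<not> b) \<in> c}|"
        using xb c unfolding c'_def ok_def by blast
      then show ?thesis
        by (rule le_card_mono) (auto simp: c'_def)
    next
      case True
      then have "b = q x" using xb new unfolding c'_def by blast
      then show ?thesis
        by (intro le_card_mono[OF sat[OF True xb(2)]]) (auto simp: c'_def opposite_def image_iff)
    qed
    ultimately have "ok c'" unfolding ok_def by blast
    then have "c' = c" using max c'_def by blast
    then show False using new unfolding c'_def by blast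
  qed
  define U where "U = - Domain c"
  have UX: "U \<subseteq> X"
  proof
    fix v assume "v \<in> U"
    then show "v \<in> X"
      using ext[of "{v}"] unfolding U_def by blast
  qed
  have degU: "d v \<le>o |N v \<inter> U|" if "v \<in> U" for v
  proof (rule ccontr)
    assume neg: "\<not> d v \<le>o |N v \<inter> U|"
    have vX: "v \<in> X" using that UX by blast
    have "N v = (N v \<inter> U) \<union> ({y \<in> N v. (y, True) \<in> c} \<union> {y \<in> N v. (y, False) \<in> c})"
      (is "_ = ?N")
    proof
      show "N v \<subseteq> ?N"
      proof
        fix y assume y: "y \<in> N v"
        show "y \<in> ?N"
        proof (cases "y \<in> U")
          case False
          then obtain b where "(y, b) \<in> c" unfolding U_def by blast
          then show ?thesis using y by (cases b) auto
        qed (use y in simp)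
      qed
    qed blast
    then have "d v \<le>o |(N v \<inter> U) \<union> ({y \<in> N v. (y, True) \<in> c} \<union> {y \<in> N v. (y, False) \<in> c})|"
      using deg[OF vX] by simp
    then have "d v \<le>o |{y \<in> N v. (y, True) \<in> c} \<union> {y \<in> N v. (y, False) \<in> c}|"
      using le_card_Un[OF d[OF vX]] neg by blast
    then obtain b where "d v \<le>o |{y \<in> N v. (y, b) \<in> c}|"
      using le_card_Un[OF d[OF vX]] by blast
    then have "d v \<le>o |{y \<in> N v. (y, \<not> \<not> b) \<in> c} \<union> (opposite N (\<lambda>_. \<not> b) v \<inter> {v})|"
      by (rule le_card_mono) auto
    then show False
      using ext[of "{v}" "\<lambda>_. \<not> b"] that unfolding U_def by blast
  qed
  have "U = {}"
  proof (rule ccontr)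
    assume "U \<noteq> {}"
    then obtain B q where B: "B \<noteq> {}" "B \<subseteq> U" "\<forall>x\<in>B. d x \<le>o |opposite N q x \<inter> B|"
      using seed[OF UX _ degU] by blast
    have "d x \<le>o |{y \<in> N x. (y, \<not> q x) \<in> c} \<union> (opposite N q x \<inter> B)|" if "x \<in> B" for x
      using B(3)[rule_format, OF that] by (rule le_card_mono) blast
    then show False
      using ext[OF B(1), of q] B(2) unfolding U_def by blast
  qed
  define p where "p x \<longleftrightarrow> (x, True) \<in> c" for x
  have sv: "single_valued c" using c by (simp add: ok_def)
  have p: "(x, b) \<in> c \<longleftrightarrow> b = p x" for x b
  proof -
    obtain b' where "(x, b') \<in> c" using \<open>U = {}\<close> unfolding U_def by blast
    moreover have "\<not> ((x, True) \<in> c \<and> (x, False) \<in> c)"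
      using sv unfolding single_valued_def by blast
    ultimately show ?thesis unfolding p_def by (cases b; cases b') auto
  qed
  have "d x \<le>o |opposite N p x|" if "x \<in> X" for x
  proof -
    have "d x \<le>o |{y \<in> N x. (y, \<not> p x) \<in> c}|"
      using c p that unfolding ok_def by blast
    moreover have "{y \<in> N x. (y, \<not> p x) \<in> c} = opposite N p x"
      unfolding p opposite_def by auto
    ultimately show ?thesis by simp
  qed
  then show ?thesis by blast
qed

section \<open>Orienting edges by transfinite removal\<close>

text \<open>By \<open>thin\<close>, whatever nonempty part of \<open>U\<close> is left, some vertex in it has few neighbours left. All
  of \<open>U\<close> can thus be removed in transfinite steps, each removing at once every vertex with fewer than
  \<open>d x\<close> remaining neighbours. With each \<open>x\<close> associate the set \<open>A x\<close> of those neighbours that are not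
  removed strictly before it. An edge goes from the end removed first, and from both ends if they are
  removed together.\<close>

lemma ex_orientation:
  assumes thin: "\<And>B. B \<subseteq> U \<Longrightarrow> B \<noteq> {} \<Longrightarrow> \<exists>x\<in>B. |G x \<inter> B| <o d x"
  shows "\<exists>A. (\<forall>x\<in>U. |A x| <o d x) \<and>
    (\<forall>x\<in>U. \<forall>y\<in>U. y \<in> G x \<longrightarrow> x \<in> G y \<longrightarrow> y \<in> A x \<or> x \<in> A y)"
proof -
  define F where "F R = {x \<in> U. |G x \<inter> U - R| <o d x}" for R
  have mono: "monotone (\<subseteq>) (\<subseteq>) F"
    by (rule monotoneI) (unfold F_def, blast intro: card_less_mono)
  let ?T = "ccpo_class.iterates F"
  have chain: "R \<subseteq> R' \<or> R' \<subseteq> R" if "R \<in> ?T" "R' \<in> ?T" for R R'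
    using chainD[OF chain_iterates[OF mono] that] .
  \<comment> \<open>what has been removed just before \<open>x\<close>; the stages form a chain closed under unions\<close>
  define R where "R x = \<Union>{R \<in> ?T. x \<notin> R}" for x
  have RT: "R x \<in> ?T" for x
    unfolding R_def
  proof (rule ccpo_class.iterates.Sup)
    show "Complete_Partial_Order.chain (\<subseteq>) {R \<in> ?T. x \<notin> R}"
      using chain by (intro chainI) blast
  qed blast
  have xR: "x \<notin> R x" for x unfolding R_def by blast
  have small: "|G x \<inter> U - R x| <o d x" if xU: "x \<in> U" for x
  proof -
    have "x \<in> F (R x)"
    proof (rule ccontr)
      assume "x \<notin> F (R x)"
      then have "F (R x) \<subseteq> R x"
        unfolding R_def using ccpo_class.iterates.step[OF RT[of x], unfolded R_def] by blast
      moreover obtain z where "z \<in> U - R x" "|G z \<inter> (U - R x)| <o d z"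
        using thin[of "U - R x"] xU xR by blast
      ultimately show False
        unfolding F_def by (auto simp: Int_Diff)
    qed
    then show ?thesis by (simp add: F_def)
  qed
  have "y \<in> G x \<inter> U - R x \<or> x \<in> G y \<inter> U - R y"
    if "x \<in> U" "y \<in> U" "y \<in> G x" "x \<in> G y" for x y
  proof -
    have "\<not> (y \<in> R x \<and> x \<in> R y)"
      using chain[OF RT[of x] RT[of y]] xR by blast
    then show ?thesis using that by blast
  qed
  then show ?thesis
    by (intro exI[of _ "\<lambda>x. G x \<inter> U - R x"]) (use small in simp)
qed

section \<open>Recolouring small components\<close>

text \<open>A recursion of length \<open>\<kappa>\<close>: at stage \<open>\<delta>\<close> fewer than \<open>\<kappa>\<close> sets \<open>C (Y \<eta>)\<close>, each of size below \<open>\<kappa>\<close>, have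
  been used up, and their union cannot exhaust \<open>M (t \<delta>)\<close> because \<open>\<kappa>\<close> is stable. The index \<open>t \<delta>\<close>
  treated at stage \<open>\<delta>\<close> takes every value \<open>\<kappa>\<close> times.\<close>

lemma separated_representatives:
  fixes \<kappa> :: "'b rel" and M :: "'i \<Rightarrow> 'a set"
  assumes \<kappa>: "Cinfinite \<kappa>" "stable \<kappa>"
    and I: "I \<noteq> {}" "|I| \<le>o \<kappa>"
    and M: "\<And>i. i \<in> I \<Longrightarrow> \<kappa> \<le>o |M i|"
    and C: "\<And>y. |C y| <o \<kappa>"
  shows "\<exists>(t :: 'b \<Rightarrow> 'i) Y.
    (\<forall>\<delta>\<in>Field \<kappa>. t \<delta> \<in> I \<and> Y \<delta> \<in> M (t \<delta>) \<and> (\<forall>\<eta>\<in>underS \<kappa> \<delta>. Y \<delta> \<notin> C (Y \<eta>))) \<and>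
    (\<forall>i\<in>I. \<kappa> \<le>o |{\<delta> \<in> Field \<kappa>. t \<delta> = i}| )"
proof -
  have co: "Card_order \<kappa>" and inf: "infinite (Field \<kappa>)"
    using \<kappa> by (simp_all add: cinfinite_def)
  have Fk: "|Field \<kappa>| =o \<kappa>" "\<kappa> =o |Field \<kappa>|"
    by (rule card_of_Field_ordIso[OF co], rule ordIso_symmetric[OF card_of_Field_ordIso[OF co]])
  have "|I \<times> Field \<kappa>| \<le>o \<kappa>"
    by (rule card_of_Times_ordLeq_infinite_Field[OF inf I(2) ordIso_imp_ordLeq[OF Fk(1)] co])
  then have "|I \<times> Field \<kappa>| \<le>o |Field \<kappa>|"
    using Fk(2) by (rule ordLeq_ordIso_trans)
  moreover have "I \<times> Field \<kappa> \<noteq> {}" using I(1) inf by auto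
  ultimately obtain g where g: "g ` Field \<kappa> = I \<times> Field \<kappa>"
    using card_of_ordLeq2[of "I \<times> Field \<kappa>" "Field \<kappa>"] by blast
  define t where "t = fst \<circ> g"
  have tI: "t \<delta> \<in> I" if "\<delta> \<in> Field \<kappa>" for \<delta>
  proof -
    have "g \<delta> \<in> I \<times> Field \<kappa>" using g that by blast
    then show ?thesis by (simp add: t_def mem_Times_iff)
  qed
  have fibre: "\<kappa> \<le>o |{\<delta> \<in> Field \<kappa>. t \<delta> = i}|" if "i \<in> I" for i
  proof -
    have "Field \<kappa> \<subseteq> (snd \<circ> g) ` {\<delta> \<in> Field \<kappa>. t \<delta> = i}"
    proof
      fix \<xi> assume "\<xi> \<in> Field \<kappa>"
      then have "(i, \<xi>) \<in> g ` Field \<kappa>" using g that by blast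
      then obtain \<delta> where "\<delta> \<in> Field \<kappa>" "g \<delta> = (i, \<xi>)" by auto
      then show "\<xi> \<in> (snd \<circ> g) ` {\<delta> \<in> Field \<kappa>. t \<delta> = i}"
        by (intro image_eqI[of _ _ \<delta>]) (simp_all add: t_def)
    qed
    then have "|Field \<kappa>| \<le>o |{\<delta> \<in> Field \<kappa>. t \<delta> = i}|"
      by (rule ordLeq_transitive[OF card_of_mono1 card_of_image])
    with Fk(2) show ?thesis
      by (rule ordIso_ordLeq_trans)
  qed
  define P where "P Y \<delta> y \<longleftrightarrow>
    (\<delta> \<in> Field \<kappa> \<longrightarrow> y \<in> M (t \<delta>) \<and> (\<forall>\<eta>\<in>underS \<kappa> \<delta>. y \<notin> C (Y \<eta>)))" for Y \<delta> y
  have "\<exists>Y. \<forall>\<delta>. P Y \<delta> (Y \<delta>)"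
  proof (rule dependent_wf_choice)
    show "wf (\<kappa> - Id)"
      using co by (simp add: card_order_on_def well_order_on_def)
    fix Y Z :: "'b \<Rightarrow> 'a" and \<delta> y assume "\<And>\<eta>. (\<eta>, \<delta>) \<in> \<kappa> - Id \<Longrightarrow> Y \<eta> = Z \<eta>"
    then have "Y \<eta> = Z \<eta>" if "\<eta> \<in> underS \<kappa> \<delta>" for \<eta>
      using that by (simp add: underS_def)
    then show "P Y \<delta> y = P Z \<delta> y"
      by (simp add: P_def)
  next
    fix \<delta> and Y :: "'b \<Rightarrow> 'a"
    show "\<exists>y. P Y \<delta> y"
    proof (cases "\<delta> \<in> Field \<kappa>")
      case True
      have "|\<Union>\<eta>\<in>underS \<kappa> \<delta>. C (Y \<eta>)| <o \<kappa>"
        by (rule stable_UNION[OF \<kappa>(2) card_of_underS[OF co True] C])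
      then have "|\<Union>\<eta>\<in>underS \<kappa> \<delta>. C (Y \<eta>)| <o |M (t \<delta>)|"
        using M[OF tI[OF True]] by (rule ordLess_ordLeq_trans)
      then have "\<not> M (t \<delta>) \<subseteq> (\<Union>\<eta>\<in>underS \<kappa> \<delta>. C (Y \<eta>))"
        using not_ordLess_ordLeq card_of_mono1[of "M (t \<delta>)"] by blast
      then show ?thesis unfolding P_def by blast
    qed (simp add: P_def)
  qed
  then obtain Y where Y: "\<And>\<delta>. P Y \<delta> (Y \<delta>)" by blast
  show ?thesis
    by (intro exI[of _ t] exI[of _ Y]) (use tI Y fibre in \<open>simp add: P_def\<close>)
qed

text \<open>Exchanging the colours on some components of \<open>r\<close> changes no relation \<open>p x \<noteq> p y\<close> along \<open>r\<close>. The
  tasks are pairs \<open>(x, c)\<close>: make an element of \<open>M x\<close> receive the colour \<open>c\<close>. Each task is treated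
  \<open>\<kappa>\<close> times, always with an element whose component is untouched so far, so that its colour is
  still free to choose.\<close>

lemma recolour_components:
  fixes \<kappa> :: "'b rel" and H :: "'h set" and p :: "'a \<Rightarrow> bool"
  assumes \<kappa>: "Cinfinite \<kappa>" "stable \<kappa>"
    and r: "sym r" "\<And>y. |r\<^sup>* `` {y}| <o \<kappa>"
    and H: "|H| \<le>o \<kappa>" "\<And>x. x \<in> H \<Longrightarrow> \<kappa> \<le>o |M x|"
  shows "\<exists>q :: 'a \<Rightarrow> bool. (\<forall>(x, y)\<in>r. q x \<noteq> q y \<longleftrightarrow> p x \<noteq> p y) \<and>
    (\<forall>x\<in>H. \<forall>c. \<kappa> \<le>o |{y \<in> M x. q y = c}| )"
proof (cases "H = {}")
  case True
  then show ?thesis by (intro exI[of _ p]) auto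
next
  case False
  have co: "Card_order \<kappa>" and inf: "infinite (Field \<kappa>)"
    using \<kappa> by (simp_all add: cinfinite_def)
  have "|UNIV :: bool set| \<le>o \<kappa>"
    by (intro ordLess_imp_ordLeq finite_card_less \<kappa>) simp
  then have HB: "|H \<times> (UNIV :: bool set)| \<le>o \<kappa>"
    using card_of_Times_ordLeq_infinite_Field[OF inf H(1) _ co] by blast
  have ne: "H \<times> (UNIV :: bool set) \<noteq> {}" using False by simp
  have MB: "\<kappa> \<le>o |M (fst i)|" if "i \<in> H \<times> (UNIV :: bool set)" for i
    using that H(2) by auto
  obtain t :: "'b \<Rightarrow> 'h \<times> bool" and Y where
    t: "\<forall>\<delta>\<in>Field \<kappa>. t \<delta> \<in> H \<times> UNIV \<and> Y \<delta> \<in> M (fst (t \<delta>)) \<and>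
      (\<forall>\<eta>\<in>underS \<kappa> \<delta>. Y \<delta> \<notin> r\<^sup>* `` {Y \<eta>})" and
    fibre: "\<forall>i\<in>H \<times> UNIV. \<kappa> \<le>o |{\<delta> \<in> Field \<kappa>. t \<delta> = i}|"
    using separated_representatives[where M = "\<lambda>i. M (fst i)" and C = "\<lambda>y. r\<^sup>* `` {y}",
        OF \<kappa> ne HB MB r(2)]
    by blast
  have sym: "(x, y) \<in> r\<^sup>* \<Longrightarrow> (y, x) \<in> r\<^sup>*" for x y
    using symD[OF sym_rtrancl[OF r(1)]] .
  have apart: "\<delta> = \<eta>" if "(Y \<delta>, Y \<eta>) \<in> r\<^sup>*" "\<delta> \<in> Field \<kappa>" "\<eta> \<in> Field \<kappa>" for \<delta> \<eta>
  proof (rule ccontr)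
    assume "\<delta> \<noteq> \<eta>"
    moreover have "Total \<kappa>"
      using co by (simp add: card_order_on_def well_order_on_def linear_order_on_def)
    ultimately have "\<eta> \<in> underS \<kappa> \<delta> \<or> \<delta> \<in> underS \<kappa> \<eta>"
      using that(2,3) by (auto simp: total_on_def underS_def)
    then show False
      using t that sym by blast
  qed
  \<comment> \<open>exchange colours on the component of \<open>Y \<delta>\<close> if \<open>p\<close> gives \<open>Y \<delta>\<close> the wrong colour; by \<open>apart\<close> no
    component is asked to change twice\<close>
  define q where
    "q v = (if \<exists>\<delta>\<in>Field \<kappa>. (Y \<delta>, v) \<in> r\<^sup>* \<and> p (Y \<delta>) \<noteq> snd (t \<delta>) then \<not> p v else p v)" for v
  have qY: "q (Y \<delta>) = snd (t \<delta>)" if "\<delta> \<in> Field \<kappa>" for \<delta>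
    using apart[OF _ _ that] that unfolding q_def by auto
  have "q x \<noteq> q y \<longleftrightarrow> p x \<noteq> p y" if xy: "(x, y) \<in> r" for x y
  proof -
    have "(Y \<delta>, x) \<in> r\<^sup>* \<longleftrightarrow> (Y \<delta>, y) \<in> r\<^sup>*" for \<delta>
      using rtrancl_into_rtrancl[of "Y \<delta>"] xy symD[OF r(1) xy] by blast
    then show ?thesis unfolding q_def by auto
  qed
  moreover have "\<kappa> \<le>o |{y \<in> M x. q y = c}|" if x: "x \<in> H" for x c
  proof -
    have "inj_on Y {\<delta> \<in> Field \<kappa>. t \<delta> = (x, c)}"
      by (rule inj_onI) (use apart in auto)
    moreover have "Y ` {\<delta> \<in> Field \<kappa>. t \<delta> = (x, c)} \<subseteq> {y \<in> M x. q y = c}"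
      using t qY by fastforce
    ultimately have "|{\<delta> \<in> Field \<kappa>. t \<delta> = (x, c)}| \<le>o |{y \<in> M x. q y = c}|"
      using card_of_ordLeq[of "{\<delta> \<in> Field \<kappa>. t \<delta> = (x, c)}" "{y \<in> M x. q y = c}"] by blast
    moreover have "\<kappa> \<le>o |{\<delta> \<in> Field \<kappa>. t \<delta> = (x, c)}|"
      using fibre x by blast
    ultimately show ?thesis
      by (rule ordLeq_transitive[rotated])
  qed
  ultimately show ?thesis by (intro exI[of _ q]) auto
qed

section \<open>Finitely many demands\<close>

text \<open>If \<open>p\<close> itself does not meet all demands within some nonempty subset, then the edges between its
  colour classes have an orientation of small out-degrees \<open>A\<close>. Each low vertex \<open>x\<close> then secures a set
  \<open>S x\<close> of \<open>d x\<close> opposite neighbours along edges directed towards \<open>x\<close>. The direction is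
  what bounds the degree of the secured graph \<open>r\<close>: a vertex may be chosen by many others, but each
  such choice uses one of its few outgoing edges.\<close>

lemma one_more_demand:
  fixes \<kappa> :: "'b rel" and d :: "'a \<Rightarrow> 'b rel"
  assumes sym: "\<And>x y. y \<in> N x \<Longrightarrow> x \<in> N y"
    and \<kappa>: "Cinfinite \<kappa>" "stable \<kappa>"
    and U: "U \<noteq> {}" "|U| \<le>o \<kappa>"
    and d: "\<And>x. x \<in> U \<Longrightarrow> Cinfinite (d x)" "\<And>x. x \<in> U \<Longrightarrow> d x \<le>o \<kappa>"
    and deg: "\<And>x. x \<in> U \<Longrightarrow> d x \<le>o |N x \<inter> U|"
    and low: "\<And>x. x \<in> U \<Longrightarrow> d x <o \<kappa> \<Longrightarrow> d x \<le>o |opposite N p x \<inter> U|"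
  shows "\<exists>B q. B \<noteq> {} \<and> B \<subseteq> U \<and> (\<forall>x\<in>B. d x \<le>o |opposite N q x \<inter> B| )"
proof (rule ccontr)
  assume contra: "\<not> ?thesis"
  have co: "Card_order \<kappa>" and inf: "infinite (Field \<kappa>)"
    using \<kappa> by (simp_all add: cinfinite_def)
  have thin: "\<exists>x\<in>B. |opposite N p x \<inter> B| <o d x" if B: "B \<subseteq> U" "B \<noteq> {}" for B
  proof -
    obtain x where x: "x \<in> B" "\<not> d x \<le>o |opposite N p x \<inter> B|"
      using contra[unfolded not_ex, rule_format, of B p] B by blast
    have "Card_order (d x)" using d(1)[of x] x(1) B by blast
    then have "|opposite N p x \<inter> B| <o d x" using x(2) by (simp add: not_le_card_iff)
    then show ?thesis using x(1) by blast
  qed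
  obtain A where A:
    "\<And>x. x \<in> U \<Longrightarrow> |A x| <o d x"
    "\<And>x y. x \<in> U \<Longrightarrow> y \<in> U \<Longrightarrow> y \<in> opposite N p x \<Longrightarrow> x \<in> opposite N p y \<Longrightarrow> y \<in> A x \<or> x \<in> A y"
    using ex_orientation[of U "opposite N p" d, OF thin] by blast
  have opp_sym: "y \<in> opposite N p x \<Longrightarrow> x \<in> opposite N p y" for x y
    using sym unfolding opposite_def by auto
  define L where "L = {x \<in> U. d x <o \<kappa>}"
  have "\<exists>S. S \<subseteq> opposite N p x \<inter> U - A x \<and> |S| =o d x" if "x \<in> L" for x
  proof -
    have x: "x \<in> U" "d x <o \<kappa>" using that by (simp_all add: L_def)
    have "d x \<le>o |A x \<union> (opposite N p x \<inter> U - A x)|"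
      by (rule le_card_mono[OF low[OF x]]) blast
    then have "d x \<le>o |A x| \<or> d x \<le>o |opposite N p x \<inter> U - A x|"
      by (rule le_card_Un[OF d(1)[OF x(1)]])
    then have "d x \<le>o |opposite N p x \<inter> U - A x|"
      using not_ordLess_ordLeq[OF A(1)[OF x(1)]] by blast
    then show ?thesis
      using obtain_subset_of_card[of "d x"] d(1)[OF x(1)] by metis
  qed
  then obtain S where S: "\<And>x. x \<in> L \<Longrightarrow> S x \<subseteq> opposite N p x \<inter> U - A x"
    "\<And>x. x \<in> L \<Longrightarrow> |S x| =o d x"
    by metis
  define r where "r = {(x, y). x \<in> L \<and> y \<in> S x} \<union> {(y, x). x \<in> L \<and> y \<in> S x}"
  have symr: "sym r" unfolding r_def sym_def by blast
  have deg_r: "|r `` {x}| <o \<kappa>" for x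
  proof (cases "x \<in> U")
    case True
    have Ax: "|A x| <o \<kappa>"
      using A(1)[OF True] d(2)[OF True] by (rule ordLess_ordLeq_trans)
    have Sx: "|if x \<in> L then S x else {}| <o \<kappa>"
      using S(2)[of x] ordIso_ordLess_trans[of "|S x|" "d x" \<kappa>] finite_card_less[OF \<kappa>(1), of "{}"]
      by (auto simp: L_def)
    have "r `` {x} \<subseteq> A x \<union> (if x \<in> L then S x else {})"
    proof
      fix y assume "y \<in> r `` {x}"
      then consider "x \<in> L" "y \<in> S x" | "y \<in> L" "x \<in> S y"
        unfolding r_def by blast
      then show "y \<in> A x \<union> (if x \<in> L then S x else {})"
      proof cases
        case 2
        then have "y \<in> U" "x \<in> opposite N p y" "x \<notin> A y"
          using S(1) by (auto simp: L_def)
        then have "y \<in> A x"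
          using A(2)[OF True, of y] opp_sym by blast
        then show ?thesis by blast
      qed simp
    qed
    then show ?thesis
      using card_of_Un_ordLess_infinite_Field[OF inf co Ax Sx] by (rule card_less_mono[rotated])
  next
    case False
    then have "r `` {x} = {}"
      using S(1) unfolding r_def L_def by blast
    then show ?thesis using finite_card_less[OF \<kappa>(1), of "{}"] by simp
  qed
  have comp: "|r\<^sup>* `` {x}| <o \<kappa>" for x
  proof (cases "L = {}")
    case True
    then have "r = {}" unfolding r_def by blast
    then show ?thesis using finite_card_less[OF \<kappa>(1), of "{x}"] by simp
  next
    case False
    then obtain y where "y \<in> U" "d y <o \<kappa>" unfolding L_def by blast
    \<comment> \<open>a low demand is infinite and below \<open>\<kappa>\<close>, so \<open>\<kappa>\<close> is uncountable\<close>
    then have "natLeq <o \<kappa>"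
      using ordLeq_ordLess_trans[OF natLeq_ordLeq_cinfinite[OF d(1)]] by blast
    then show ?thesis
      using card_rtrancl_less[OF \<kappa> _ deg_r] by blast
  qed
  define H where "H = U - L"
  have Hd: "x \<in> U" "\<kappa> \<le>o d x" if "x \<in> H" for x
  proof -
    show "x \<in> U" using that by (simp add: H_def)
    have "\<not> d x <o \<kappa>" using that by (simp add: H_def L_def)
    then show "\<kappa> \<le>o d x"
      using not_ordLess_iff_ordLeq[of \<kappa> "d x"] d(1)[OF \<open>x \<in> U\<close>] co
      by (simp add: card_order_on_def)
  qed
  have H\<kappa>: "|H| \<le>o \<kappa>"
    by (rule ordLeq_transitive[OF card_of_mono1 U(2)]) (simp add: H_def)
  have degH: "\<kappa> \<le>o |N x \<inter> U|" if "x \<in> H" for x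
    using Hd(2)[OF that] deg[OF Hd(1)[OF that]] by (rule ordLeq_transitive)
  obtain q :: "'a \<Rightarrow> bool" where q:
    "\<forall>(x, y)\<in>r. q x \<noteq> q y \<longleftrightarrow> p x \<noteq> p y"
    "\<forall>x\<in>H. \<forall>c. \<kappa> \<le>o |{y \<in> N x \<inter> U. q y = c}|"
    using recolour_components[where p = p and M = "\<lambda>x. N x \<inter> U", OF \<kappa> symr comp H\<kappa> degH] by blast
  have "d x \<le>o |opposite N q x \<inter> U|" if "x \<in> U" for x
  proof (cases "x \<in> L")
    case True
    have "S x \<subseteq> opposite N q x \<inter> U"
    proof
      fix y assume y: "y \<in> S x"
      then have "(x, y) \<in> r" using True by (simp add: r_def)
      then show "y \<in> opposite N q x \<inter> U"
        using q(1) S(1)[OF True] y unfolding opposite_def by fastforce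
    qed
    with ordIso_imp_ordLeq[OF ordIso_symmetric[OF S(2)[OF True]]] show ?thesis
      by (rule le_card_mono)
  next
    case False
    then have "\<kappa> \<le>o |{y \<in> N x \<inter> U. q y = (\<not> q x)}|"
      using q(2) that by (simp add: H_def)
    then have "\<kappa> \<le>o |opposite N q x \<inter> U|"
      by (rule le_card_mono) (auto simp: opposite_def)
    with d(2)[OF that] show ?thesis by (rule ordLeq_transitive)
  qed
  then show False using contra[unfolded not_ex, rule_format, of U q] U(1) by blast
qed

lemma ex_max_card_order:
  assumes "finite K" "K \<noteq> {}" "\<And>k. k \<in> K \<Longrightarrow> Card_order k"
  shows "\<exists>m\<in>K. \<forall>k\<in>K. k \<le>o m"
  using assms
proof (induction K rule: finite_ne_induct)
  case (singleton k)
  then show ?case by (auto intro: ordLeq_refl)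
next
  case (insert k K)
  then obtain m where m: "m \<in> K" "\<forall>l\<in>K. l \<le>o m" by blast
  have "k \<le>o m \<or> m \<le>o k"
    using insert.prems m(1) by (intro ordLeq_total) (auto simp: card_order_on_def)
  then show ?case
  proof
    assume "m \<le>o k"
    moreover have "k \<le>o k" using insert.prems by (simp add: ordLeq_refl)
    ultimately show ?thesis
      using m ordLeq_transitive[of _ m k] by blast
  qed (use m in blast)
qed

text \<open>Induction on the set of values, removing the largest one, \<open>\<kappa>\<close>. The exchange of colours
  can serve at most \<open>\<kappa>\<close> vertices of demand \<open>\<kappa>\<close>, so the uncoloured part \<open>U\<close> is first cut down to a set \<open>W\<close>
  closed under choosing \<open>d x\<close> neighbours. The induction hypothesis is applied to the graph induced on
  \<open>W\<close> and to its vertices of demand below \<open>\<kappa>\<close>.\<close>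

theorem unfriendly_for_finitely_many_stable_demands:
  fixes d :: "'a \<Rightarrow> 'b rel"
  assumes "finite K" "\<And>k. k \<in> K \<Longrightarrow> Cinfinite k \<and> stable k"
    and "\<And>x y. y \<in> N x \<Longrightarrow> x \<in> N y"
    and "\<And>x. x \<in> X \<Longrightarrow> d x \<in> K" "\<And>x. x \<in> X \<Longrightarrow> d x \<le>o |N x|"
  shows "\<exists>p. \<forall>x\<in>X. d x \<le>o |opposite N p x|"
  using assms
proof (induction K arbitrary: N X rule: finite_psubset_induct)
  case (psubset K)
  note K = psubset.prems(1) and sym = psubset.prems(2) and dK = psubset.prems(3)
  have d: "Cinfinite (d x)" if "x \<in> X" for x using K dK[OF that] by blast
  show ?case
  proof (rule unfriendly_by_exhaustion[OF d psubset.prems(4)])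
    fix U assume UX: "U \<subseteq> X" and "U \<noteq> {}" and deg: "\<And>x. x \<in> U \<Longrightarrow> d x \<le>o |N x \<inter> U|"
    then obtain v where v: "v \<in> U" by blast
    then have "K \<noteq> {}" using UX dK by blast
    then obtain \<kappa> where \<kappa>K: "\<kappa> \<in> K" and max: "\<forall>k\<in>K. k \<le>o \<kappa>"
      using ex_max_card_order[OF psubset.hyps] K by blast
    have \<kappa>: "Cinfinite \<kappa>" "stable \<kappa>" using K[OF \<kappa>K] by simp_all
    have dU: "Cinfinite (d x)" "d x \<le>o \<kappa>" if "x \<in> U" for x
      using d dK max UX that by blast+
    have "\<exists>Q. Q \<subseteq> N x \<inter> U \<and> |Q| =o d x" if "x \<in> U" for x
      using obtain_subset_of_card[OF conjunct2[OF dU(1)[OF that]] deg[OF that]] by metis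
    then obtain Q where Q: "\<And>x. x \<in> U \<Longrightarrow> Q x \<subseteq> N x \<inter> U" "\<And>x. x \<in> U \<Longrightarrow> |Q x| =o d x"
      by metis
    define s where "s = {(x, y). x \<in> U \<and> y \<in> Q x}"
    define W where "W = s\<^sup>* `` {v}"
    have succ: "Cinfinite (cardSuc \<kappa>)" "stable (cardSuc \<kappa>)"
      using Cinfinite_cardSuc[OF \<kappa>(1)] regularCard_stable regularCard_cardSuc[OF \<kappa>(1)]
      by (auto simp: cinfinite_def)
    \<comment> \<open>size at most \<open>\<kappa>\<close> is treated as size below the successor, which is regular and uncountable\<close>
    have less_succ: "|B| <o cardSuc \<kappa> \<longleftrightarrow> |B| \<le>o \<kappa>" for B :: "'a set"
      using cardSuc_ordLeq_ordLess[OF conjunct2[OF \<kappa>(1)] card_of_Card_order] .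
    have out: "|s `` {x}| \<le>o \<kappa>" for x
    proof (cases "x \<in> U")
      case True
      then have "s `` {x} = Q x" by (auto simp: s_def)
      then show ?thesis
        using ordIso_ordLeq_trans[OF Q(2)[OF True] dU(2)[OF True]] by simp
    next
      case False
      then have "s `` {x} = {}" by (auto simp: s_def)
      then show ?thesis
        using ordLess_imp_ordLeq[OF finite_card_less[OF \<kappa>(1), of "{}"]] by simp
    qed
    have natLeq_succ: "natLeq <o cardSuc \<kappa>"
      using natLeq_ordLeq_cinfinite[OF \<kappa>(1)] cardSuc_greater[OF conjunct2[OF \<kappa>(1)]]
      by (rule ordLeq_ordLess_trans)
    have W\<kappa>: "|W| \<le>o \<kappa>"
      unfolding W_def less_succ[symmetric]
      by (rule card_rtrancl_less[OF succ natLeq_succ]) (simp only: less_succ out)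
    have vW: "v \<in> W" unfolding W_def by blast
    have WU: "W \<subseteq> U"
    proof
      fix x assume "x \<in> W"
      then have "(v, x) \<in> s\<^sup>*" by (simp add: W_def)
      then show "x \<in> U"
        by induction (use v Q(1) in \<open>auto simp: s_def\<close>)
    qed
    have QW: "Q x \<subseteq> W" if "x \<in> W" for x
      using that WU unfolding W_def s_def by (auto intro: rtrancl.rtrancl_into_rtrancl)
    have degW: "d x \<le>o |N x \<inter> W|" if "x \<in> W" for x
    proof (rule le_card_mono)
      show "d x \<le>o |Q x|"
        using Q(2) that WU ordIso_imp_ordLeq ordIso_symmetric by blast
      show "Q x \<subseteq> N x \<inter> W" using Q(1) QW that WU by blast
    qed
    define N' where "N' x = (if x \<in> W then N x \<inter> W else {})" for x
    have "\<exists>p. \<forall>x\<in>{x \<in> W. d x <o \<kappa>}. d x \<le>o |opposite N' p x|"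
    proof (rule psubset.IH[of "{k \<in> K. k <o \<kappa>}"])
      show "{k \<in> K. k <o \<kappa>} \<subset> K"
        using \<kappa>K ordLess_irreflexive by blast
      show "x \<in> N' y" if "y \<in> N' x" for x y
        using that sym by (auto simp: N'_def split: if_splits)
    qed (use K dK degW WU UX in \<open>auto simp: N'_def\<close>)
    then obtain p where p: "\<And>x. x \<in> W \<Longrightarrow> d x <o \<kappa> \<Longrightarrow> d x \<le>o |opposite N' p x|" by blast
    have "\<exists>B q. B \<noteq> {} \<and> B \<subseteq> W \<and> (\<forall>x\<in>B. d x \<le>o |opposite N q x \<inter> B| )"
    proof (rule one_more_demand[OF sym \<kappa> _ W\<kappa>])
      fix x assume x: "x \<in> W" "d x <o \<kappa>"
      have "opposite N' p x = opposite N p x \<inter> W"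
        using x by (auto simp: opposite_def N'_def)
      then show "d x \<le>o |opposite N p x \<inter> W|" using p[OF x] by simp
    qed (use vW WU dU degW in blast)+
    then show "\<exists>B q. B \<noteq> {} \<and> B \<subseteq> U \<and> (\<forall>x\<in>B. d x \<le>o |opposite N q x \<inter> B| )"
      using WU by blast
  qed
qed

section \<open>Demands in a graph of infinite minimum degree\<close>

lemma is_omega_Cinfinite_stable: "is_omega n k \<Longrightarrow> Cinfinite k \<and> stable k"
proof (induction n arbitrary: k)
  case 0
  then have "k =o natLeq" by simp
  then show ?case
    using Cinfinite_cong[OF ordIso_symmetric] natLeq_Cinfinite stable_ordIso1[OF stable_natLeq] by blast
next
  case (Suc n)
  then obtain s :: "'a rel" where s: "is_omega n s" "k =o cardSuc s" by auto
  then have inf: "Cinfinite s" using Suc.IH by blast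
  have "Cinfinite (cardSuc s)" using Cinfinite_cardSuc[OF inf] .
  moreover from this have "stable (cardSuc s)"
    using regularCard_stable regularCard_cardSuc[OF inf] by (auto simp: cinfinite_def)
  ultimately show ?case
    using Cinfinite_cong[OF ordIso_symmetric[OF s(2)]] stable_ordIso1[OF _ s(2)] by blast
qed

text \<open>The cardinals between \<open>\<omega>\<^sub>0\<close> and \<open>\<omega>\<^sub>n\<close> are \<open>\<omega>\<^sub>0, \<dots>, \<omega>\<^sub>n\<close>. This is what makes the number of
  demands finite, whatever the degrees are.\<close>

lemma infinite_set_cases:
  fixes A :: "'a set"
  assumes "infinite A"
  obtains k :: "'a rel" where "is_omega n k" "k \<le>o |A|"
  | i where "i < n" "is_omega i |A|"
proof (induction n arbitrary: thesis)
  case 0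
  have "natLeq \<le>o |A|" using assms infinite_iff_natLeq_ordLeq by blast
  then obtain k :: "'a rel" where "natLeq =o k" "k \<le>o |A|"
    using internalize_ordLeq[of natLeq "|A|"] by blast
  then show ?case using 0(1)[of k] ordIso_symmetric by auto
next
  case (Suc n)
  show ?case
  proof (rule Suc.IH)
    fix i assume "i < n" "is_omega i |A|"
    then show thesis using Suc.prems(2) less_SucI by blast
  next
    fix k :: "'a rel" assume k: "is_omega n k" "k \<le>o |A|"
    show thesis
    proof (cases "k <o |A|")
      case True
      then have "cardSuc k \<le>o |A|"
        using cardSuc_least is_omega_Card_order[OF k(1)] card_of_Card_order by blast
      then obtain l :: "'a rel" where "cardSuc k =o l" "l \<le>o |A|"
        using internalize_ordLeq[of "cardSuc k" "|A|"] by blast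
      then show thesis
        using Suc.prems(1)[of l] k(1) ordIso_symmetric by auto
    next
      case False
      then have "|A| =o k"
        using k(2) ordLeq_iff_ordLess_or_ordIso ordIso_symmetric by blast
      then have "is_omega n |A|" by (rule is_omega_ordIso[OF k(1)])
      then show thesis using Suc.prems(2) by blast
    qed
  qed
qed

theorem corollary1p2:
  fixes V :: "'a set" and E :: "'a set set" and n :: nat
  assumes "graph V E"
    and "cinfinite (min_degree V E)"
  shows "\<exists>p. omega_unfriendly n V E p"
proof -
  define N where "N = (\<lambda>x. if x \<in> V then neighbours V E x else {})"
  have NV: "N x = neighbours V E x" if "x \<in> V" for x using that by (simp add: N_def)
  have inf: "infinite (N x)" if "x \<in> V" for x
    using cinfinite_min_degree_iff[of V E] assms(2) that NV by auto
  have sym: "x \<in> N y" if "y \<in> N x" for x y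
    using that by (auto simp: N_def neighbours_def insert_commute split: if_splits)
  \<comment> \<open>one representative of each \<open>\<omega>\<^sub>i\<close> that exists at this type: \<open>K\<close> must be finite as a set of
    relations, not only up to \<open>=o\<close>\<close>
  define w :: "nat \<Rightarrow> 'a rel" where "w i = (SOME k. is_omega i k)" for i
  have w: "is_omega i (w i)" if "is_omega i k" for i and k :: "'a rel"
    unfolding w_def using someI[of "is_omega i"] that by blast
  define K where "K = w ` {i. i \<le> n \<and> (\<exists>k::'a rel. is_omega i k)}"
  have "\<exists>k\<in>K. k \<le>o |N x| \<and> (is_omega n k \<or> k =o |N x| )" if "x \<in> V" for x
    using infinite_set_cases[OF inf[OF that], of n]
  proof cases
    case (1 k)
    then have "w n =o k" using is_omega_unique w by blast
    then have "w n \<le>o |N x|" using 1(2) by (rule ordIso_ordLeq_trans)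
    then show ?thesis using w[OF 1(1)] 1(1) by (auto simp: K_def)
  next
    case (2 i)
    then have "w i =o |N x|" using is_omega_unique w by blast
    moreover have "w i \<in> K" using 2 by (auto simp: K_def)
    ultimately show ?thesis using ordIso_imp_ordLeq by blast
  qed
  then obtain d where d: "\<And>x. x \<in> V \<Longrightarrow> d x \<in> K" "\<And>x. x \<in> V \<Longrightarrow> d x \<le>o |N x|"
    "\<And>x. x \<in> V \<Longrightarrow> is_omega n (d x) \<or> d x =o |N x|"
    by metis
  have "\<exists>p. \<forall>x\<in>V. d x \<le>o |opposite N p x|"
  proof (rule unfriendly_for_finitely_many_stable_demands[where K = K])
    show "finite K" by (simp add: K_def)
    show "Cinfinite k \<and> stable k" if "k \<in> K" for k
      using that w is_omega_Cinfinite_stable by (auto simp: K_def)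
  qed (use sym d in blast)+
  then obtain p where p: "\<And>x. x \<in> V \<Longrightarrow> d x \<le>o |opposite N p x|" by blast
  define p' :: "'a \<Rightarrow> nat" where "p' x = (if p x then 1 else 0)" for x
  have opp: "opposite_nbrs V E p' x = opposite N p x" if "x \<in> V" for x
    using that by (auto simp: opposite_nbrs_def opposite_def N_def neighbours_def p'_def split: if_splits)
  have "omega_le_card n (opposite_nbrs V E p' x) \<or>
      |same_nbrs V E p' x| \<le>o |opposite_nbrs V E p' x|" if x: "x \<in> V" for x
    using d(3)[OF x]
  proof
    assume "is_omega n (d x)"
    then show ?thesis using p[OF x] opp[OF x] unfolding omega_le_card_def by auto
  next
    assume "d x =o |N x|"
    then have "|N x| \<le>o |opposite N p x|"
      using ordIso_ordLeq_trans[OF ordIso_symmetric p[OF x]] by blast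
    moreover have "same_nbrs V E p' x \<subseteq> N x"
      using x by (auto simp: same_nbrs_def NV neighbours_def)
    ultimately show ?thesis
      unfolding opp[OF x] using ordLeq_transitive[OF card_of_mono1] by blast
  qed
  moreover have "is_partition V p'" by (auto simp: is_partition_def p'_def)
  ultimately show ?thesis unfolding omega_unfriendly_def by blast
qed

end
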